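(* There exist a finite-sum root-finding problem $F=\frac1n\sum_{i=1}^nF_i$ on some $\mathbb{R}^d$, in which each $F_i:\mathbb{R}^d\to\mathbb{R}^d$ is Lipschitz and strongly monotone but the interpolation condition fails (there is no $x$ with $F_i(x)=0$ for all $i\in[n]$), with $x_*$ the zero of $F$, and an initial point $x_0\in\mathbb{R}^d$, such that PolyakSEG started at $x_0$ with any constant extrapolation step-size $\gamma_k=\gamma>0$ satisfying, for some $A\in(0,1)$, the stochastic critical condition $$\|F_{\mathcal S_k}(\hat x_k)-F_{\mathcal S_k}(x_k)\|\le A\|F_{\mathcal S_k}(x_k)\|\qquad\text{for all }k\ge 0$$ fails to converge to $x_*$ on every stochastic path; that is, for every realization of the samples $(\mathcal S_k)_{k\ge 0}$, the sequence $\{x_k\}$ does not converge to $x_*$.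
   Context: $\langle\cdot,\cdot\rangle$ and $\|\cdot\|$ are Euclidean; $[n]=\{1,\dots,n\}$. An operator $G$ is strongly monotone if for some $\mu>0$, $\langle G(x)-G(y),x-y\rangle\ge\mu\|x-y\|^2$ for all $x,y$. For a mini-batch $\mathcal S$ of indices from $[n]$, $F_{\mathcal S}=\frac1{|\mathcal S|}\sum_{i\in\mathcal S}F_i$. At each iteration $k$ a mini-batch $\mathcal S_k$ (of a fixed size, possibly one) is drawn uniformly from $[n]$, independently of the past. PolyakSEG: given $x_0$ and $\gamma_k>0$, for $k=0,1,\dots$: sample $\mathcal S_k$ and set $$\hat x_k=x_k-\gamma_kF_{\mathcal S_k}(x_k),\quad\alpha_k=\frac{\langle F_{\mathcal S_k}(\hat x_k),x_k-\hat x_k\rangle}{\|F_{\mathcal S_k}(\hat x_k)\|^2},\quad x_{k+1}=x_k-\alpha_kF_{\mathcal S_k}(\hat x_k).$$ Convention: if $F_{\mathcal S_k}(\hat x_k)=0$, set $\alpha_k=\min\{\alpha_{k-1},\gamma_k\}$ (with $\alpha_{-1}=\infty$), so that $x_{k+1}=x_k$.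
   Formalization: The mini-batch size is required to be smaller than n: with full batches the method is deterministic and, F being Lipschitz and strongly monotone, converges to the zero of F for every small step-size, so the claim fails there. *)

theory Defs
  imports "HOL-Library.Extended_Real" "Jordan_Normal_Form.Matrix"
begin

(* The dimension d is existentially quantified inside the theorem, so R^d is the carrier set
   carrier_vec d of real vectors with d entries, not a type. *)

definition euclidean_norm :: "real vec \<Rightarrow> real" where
  "euclidean_norm v = sqrt (v \<bullet> v)"

definition lipschitz_operator :: "nat \<Rightarrow> (real vec \<Rightarrow> real vec) \<Rightarrow> bool" where
  "lipschitz_operator d G \<longleftrightarrow>
     (\<exists>L\<ge>0. \<forall>x\<in>carrier_vec d. \<forall>y\<in>carrier_vec d.
        euclidean_norm (G x - G y) \<le> L * euclidean_norm (x - y))"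

definition strongly_monotone :: "nat \<Rightarrow> (real vec \<Rightarrow> real vec) \<Rightarrow> bool" where
  "strongly_monotone d G \<longleftrightarrow>
     (\<exists>\<mu>>0. \<forall>x\<in>carrier_vec d. \<forall>y\<in>carrier_vec d.
        (G x - G y) \<bullet> (x - y) \<ge> \<mu> * (euclidean_norm (x - y))\<^sup>2)"

definition batch_op :: "nat \<Rightarrow> (nat \<Rightarrow> real vec \<Rightarrow> real vec) \<Rightarrow> nat set \<Rightarrow> real vec \<Rightarrow> real vec" where
  "batch_op d F S x = (1 / real (card S)) \<cdot>\<^sub>v finsum_vec TYPE(real) d (\<lambda>i. F i x) S"

definition extrapolate ::
  "nat \<Rightarrow> (nat \<Rightarrow> real vec \<Rightarrow> real vec) \<Rightarrow> nat set \<Rightarrow> real \<Rightarrow> real vec \<Rightarrow> real vec" where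
  "extrapolate d F S \<gamma> x = x - \<gamma> \<cdot>\<^sub>v batch_op d F S x"

(* a is the previous step-size alpha_{k-1}; it is an extended real because alpha_{-1} = \<infinity>. *)
definition polyak_stepsize ::
  "nat \<Rightarrow> (nat \<Rightarrow> real vec \<Rightarrow> real vec) \<Rightarrow> nat set \<Rightarrow> real \<Rightarrow> ereal \<Rightarrow> real vec \<Rightarrow> ereal" where
  "polyak_stepsize d F S \<gamma> a x =
     (let x' = extrapolate d F S \<gamma> x; g = batch_op d F S x'
      in if g = 0\<^sub>v d then min a (ereal \<gamma>)
         else ereal ((g \<bullet> (x - x')) / (euclidean_norm g)\<^sup>2))"

(* The state after k iterations is the pair (x_k, alpha_{k-1}). The step-size used in an update
   is always finite, so real_of_ereal loses nothing. *)
primrec polyak_seg_state ::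
  "nat \<Rightarrow> (nat \<Rightarrow> real vec \<Rightarrow> real vec) \<Rightarrow> (nat \<Rightarrow> real) \<Rightarrow> (nat \<Rightarrow> nat set) \<Rightarrow> real vec
     \<Rightarrow> nat \<Rightarrow> real vec \<times> ereal" where
  "polyak_seg_state d F \<gamma> S x0 0 = (x0, \<infinity>)"
| "polyak_seg_state d F \<gamma> S x0 (Suc k) =
     (let (x, a) = polyak_seg_state d F \<gamma> S x0 k;
          \<alpha> = polyak_stepsize d F (S k) (\<gamma> k) a x
      in (x - real_of_ereal \<alpha> \<cdot>\<^sub>v batch_op d F (S k) (extrapolate d F (S k) (\<gamma> k) x), \<alpha>))"

definition polyak_seg ::
  "nat \<Rightarrow> (nat \<Rightarrow> real vec \<Rightarrow> real vec) \<Rightarrow> (nat \<Rightarrow> real) \<Rightarrow> (nat \<Rightarrow> nat set) \<Rightarrow> real vec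
     \<Rightarrow> nat \<Rightarrow> real vec" where
  "polyak_seg d F \<gamma> S x0 k = fst (polyak_seg_state d F \<gamma> S x0 k)"

definition stochastic_critical_condition ::
  "nat \<Rightarrow> (nat \<Rightarrow> real vec \<Rightarrow> real vec) \<Rightarrow> (nat \<Rightarrow> real) \<Rightarrow> (nat \<Rightarrow> nat set) \<Rightarrow> real vec
     \<Rightarrow> real \<Rightarrow> bool" where
  "stochastic_critical_condition d F \<gamma> S x0 A \<longleftrightarrow>
     (\<forall>k. let x = polyak_seg d F \<gamma> S x0 k; x' = extrapolate d F (S k) (\<gamma> k) x
          in euclidean_norm (batch_op d F (S k) x' - batch_op d F (S k) x)
               \<le> A * euclidean_norm (batch_op d F (S k) x))"

(* A realization of the samples: every mini-batch is a b-element subset of [n]. Sampling is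
   uniform and independent, so each finite prefix of such a sequence has positive probability. *)
definition batch_realization :: "nat \<Rightarrow> nat \<Rightarrow> (nat \<Rightarrow> nat set) \<Rightarrow> bool" where
  "batch_realization n b S \<longleftrightarrow> (\<forall>k. S k \<subseteq> {1..n} \<and> card (S k) = b)"

end

theory Submission
  imports Defs
begin

text \<open>
  The counterexample lives on the line: \<open>F\<^sub>1 x = x - 1\<close> and \<open>F\<^sub>2 x = x + 1\<close>, whose average is the
  identity, so the solution is \<open>0\<close> although neither component vanishes there. As \<open>b < n = 2\<close>, every
  mini-batch is a single index.

  In dimension one the Polyak step-size cancels the size of the second operator value: projecting
  onto the hyperplane through \<open>x'\<close> orthogonal to \<open>g \<noteq> 0\<close> simply returns the extrapolated
  point \<open>x'\<close>. Hence the method degenerates to \<open>x\<^bsub>k+1\<^esub> = x\<^sub>k - \<gamma> F\<^sub>i(x\<^sub>k)\<close>, a stochastic forward step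
  with constant \<open>\<gamma>\<close>. Close to the solution the sampled value \<open>F\<^sub>i(x\<^sub>k)\<close> has absolute value close to
  \<open>1\<close>, so the iterate is thrown back to a distance of about \<open>\<gamma>\<close>, whichever index was drawn. The
  critical condition forces \<open>\<gamma> < 1\<close>, which excludes that the extrapolation lands on the zero of
  \<open>F\<^sub>i\<close> from another point, where the convention would make the method stand still.
\<close>

(* The simplifier would otherwise turn the dimension 1 into Suc 0, and the rules below, stated for
   dimension 1, would no longer match. *)
declare One_nat_def [simp del]

definition point :: "real \<Rightarrow> real vec" where
  "point r = vec 1 (\<lambda>_. r)"

definition center :: "nat \<Rightarrow> real" where
  "center i = (if i = 1 then 1 else - 1)"

definition shift_op :: "nat \<Rightarrow> real vec \<Rightarrow> real vec" where
  "shift_op i x = x - point (center i)"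

lemma abs_center [simp]: "\<bar>center i\<bar> = 1"
  by (simp add: center_def)

lemma point_carrier [simp]: "point r \<in> carrier_vec 1" "dim_vec (point r) = 1"
  by (simp_all add: point_def)

lemma carrier_vec_1_eq: "carrier_vec 1 = range point"
proof -
  have "x = point (x $ 0)" if "x \<in> carrier_vec 1" for x
    using that by (intro eq_vecI) (auto simp: point_def)
  then show ?thesis by auto
qed

lemma point_arith [simp]:
  "point r - point s = point (r - s)"
  "point r + point s = point (r + s)"
  "a \<cdot>\<^sub>v point r = point (a * r)"
  "point r \<bullet> point s = r * s"
  "euclidean_norm (point r) = \<bar>r\<bar>"
  by (auto simp: point_def euclidean_norm_def scalar_prod_def)

lemma point_inject [simp]: "point r = point s \<longleftrightarrow> r = s"
  by (auto simp: point_def vec_eq_iff)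

lemma zero_vec_point: "0\<^sub>v 1 = point 0"
  by (auto simp: point_def)

lemma shift_op_point [simp]: "shift_op i (point r) = point (r - center i)"
  by (simp add: shift_op_def)

lemma lipschitz_shift_op: "lipschitz_operator 1 (shift_op i)"
  unfolding lipschitz_operator_def carrier_vec_1_eq
  by (intro exI[of _ 1]) auto

lemma strongly_monotone_shift_op: "strongly_monotone 1 (shift_op i)"
  unfolding strongly_monotone_def carrier_vec_1_eq
  by (intro exI[of _ 1]) (auto simp: power2_eq_square)

lemma batch_op_singleton:
  assumes "F i x \<in> carrier_vec d"
  shows "batch_op d F {i} x = F i x"
  using assms by (simp add: batch_op_def finsum_vec_insert finsum_vec_empty)

lemma batch_op_shift_op [simp]: "batch_op 1 shift_op {i} (point r) = point (r - center i)"
  by (simp add: batch_op_singleton)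

lemma batch_op_shift_op_full: "batch_op 1 shift_op {1..2} (point r) = point r"
proof -
  have *: "{1..2::nat} = insert 1 {2}" by auto
  have "finsum_vec TYPE(real) 1 (\<lambda>i. shift_op i (point r)) {1..2} = point (2 * r)"
    unfolding *
    by (simp add: finsum_vec_insert finsum_vec_empty center_def)
  then show ?thesis by (simp add: batch_op_def)
qed

lemma extrapolate_shift_op [simp]:
  "extrapolate 1 shift_op {i} \<gamma> (point r) = point (r - \<gamma> * (r - center i))"
  by (simp add: extrapolate_def)

text \<open>
  With \<open>h = r - center i\<close> the second operator value is \<open>g = (1 - \<gamma>) h\<close> and the step-size is
  \<open>\<gamma> / (1 - \<gamma>)\<close>, so the update subtracts \<open>\<gamma> h\<close>. If \<open>h = 0\<close> both sides are \<open>point r\<close>; this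
  is the only degenerate case since \<open>\<gamma> \<noteq> 1\<close>.
\<close>

lemma polyak_seg_Suc_eq_forward_step:
  assumes "\<gamma> \<noteq> 1" "S k = {i}" "polyak_seg 1 shift_op (\<lambda>_. \<gamma>) S x0 k = point r"
  shows "polyak_seg 1 shift_op (\<lambda>_. \<gamma>) S x0 (Suc k) = point (r - \<gamma> * (r - center i))"
proof -
  obtain a where state: "polyak_seg_state 1 shift_op (\<lambda>_. \<gamma>) S x0 k = (point r, a)"
    using assms(3) unfolding polyak_seg_def by (metis prod.collapse)
  define h where "h = r - center i"
  have g: "batch_op 1 shift_op {i} (extrapolate 1 shift_op {i} \<gamma> (point r)) = point ((1 - \<gamma>) * h)"
    by (simp add: h_def algebra_simps)
  show ?thesis
  proof (cases "h = 0")
    case True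
    then show ?thesis
      using g state assms(2) by (simp add: polyak_seg_def h_def)
  next
    case False
    have "polyak_stepsize 1 shift_op {i} \<gamma> a (point r)
        = ereal ((1 - \<gamma>) * h * (\<gamma> * h) / ((1 - \<gamma>) * h)\<^sup>2)"
      using False assms(1) unfolding polyak_stepsize_def Let_def g
      by (simp add: zero_vec_point h_def)
    also have "\<dots> = ereal (\<gamma> / (1 - \<gamma>))"
      using False assms(1) by (simp add: power2_eq_square)
    finally show ?thesis
      using g state assms(1,2) by (simp add: polyak_seg_def h_def)
  qed
qed

lemma polyak_seg_eq_point:
  assumes "\<gamma> \<noteq> 1" "\<And>k. \<exists>i. S k = {i}"
  shows "\<exists>r. polyak_seg 1 shift_op (\<lambda>_. \<gamma>) S (point r0) k = point r"
proof (induction k)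
  case 0
  then show ?case by (auto simp: polyak_seg_def)
next
  case (Suc k)
  then obtain r where r: "polyak_seg 1 shift_op (\<lambda>_. \<gamma>) S (point r0) k = point r" ..
  obtain i where i: "S k = {i}" using assms(2) by blast
  show ?case
    using polyak_seg_Suc_eq_forward_step[OF assms(1) i r] by (rule exI)
qed

text \<open>
  The first iterate already reveals the size of \<open>\<gamma>\<close>: the shifts have slope \<open>1\<close>, so the condition
  reads \<open>\<gamma> \<bar>h\<bar> \<le> A \<bar>h\<bar>\<close> with \<open>h = F\<^sub>i(x\<^sub>0) \<noteq> 0\<close>.
\<close>

lemma critical_condition_imp_stepsize_less_1:
  assumes "stochastic_critical_condition 1 shift_op (\<lambda>_. \<gamma>) S (point 0) A"
    and "A < 1" "S 0 = {i}"
  shows "\<gamma> < 1"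
proof -
  have "\<bar>\<gamma> * center i\<bar> \<le> A"
    using assms(1)[unfolded stochastic_critical_condition_def, rule_format, of 0] assms(3)
    by (simp add: Let_def polyak_seg_def)
  then show ?thesis using assms(2) by (simp add: abs_mult)
qed

text \<open>
  If \<open>\<bar>r\<bar> < \<gamma>/4\<close> with \<open>\<gamma> < 1\<close>, then \<open>\<bar>r - center i\<bar> > 3/4\<close>, so the forward step has length more than
  \<open>3\<gamma>/4\<close> and ends at distance more than \<open>\<gamma>/2\<close> from the solution \<open>0\<close>.
\<close>

lemma forward_step_leaves_neighbourhood:
  assumes "0 < \<gamma>" "\<gamma> < 1" "\<bar>r\<bar> < \<gamma> / 4"
  shows "\<gamma> / 4 < \<bar>r - \<gamma> * (r - center i)\<bar>"
proof -
  have "3 / 4 \<le> \<bar>r - center i\<bar>"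
    using assms abs_center[of i] by linarith
  then have "\<gamma> * (3 / 4) \<le> \<bar>\<gamma> * (r - center i)\<bar>"
    using assms(1) by (simp add: abs_mult mult_left_mono)
  then show ?thesis using assms by linarith
qed

lemma polyak_seg_not_convergent:
  assumes "0 < \<gamma>" "\<gamma> < 1" and S: "\<And>k. \<exists>i. S k = {i}"
  shows "\<not> (\<lambda>k. euclidean_norm (polyak_seg 1 shift_op (\<lambda>_. \<gamma>) S (point r0) k - point 0)) \<longlonglongrightarrow> 0"
    (is "\<not> ?X \<longlonglongrightarrow> 0")
proof
  assume "?X \<longlonglongrightarrow> 0"
  moreover have "0 < \<gamma> / 4" using assms(1) by simp
  ultimately have "\<forall>\<^sub>F k in sequentially. ?X k < \<gamma> / 4"
    by (rule order_tendstoD(2))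
  then obtain k where close: "?X k < \<gamma> / 4" "?X (Suc k) < \<gamma> / 4"
    unfolding eventually_sequentially by (meson le_Suc_eq order_refl)
  obtain i where i: "S k = {i}" using S by blast
  obtain r where r: "polyak_seg 1 shift_op (\<lambda>_. \<gamma>) S (point r0) k = point r"
    using polyak_seg_eq_point[of \<gamma> S r0 k] S assms(2) by auto
  have "\<gamma> / 4 < \<bar>r - \<gamma> * (r - center i)\<bar>"
    using forward_step_leaves_neighbourhood assms(1,2) close(1) by (simp add: r)
  also have "\<dots> = ?X (Suc k)"
    using polyak_seg_Suc_eq_forward_step[OF _ i r] assms(2) by simp
  finally show False using close(2) by simp
qed

theorem proposition4p4:
  shows "\<exists>(d::nat) (n::nat) (F :: nat \<Rightarrow> real vec \<Rightarrow> real vec) (xs :: real vec) (x0 :: real vec).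
    d \<ge> 1 \<and> n \<ge> 1 \<and>
    (\<forall>i\<in>{1..n}. F i \<in> carrier_vec d \<rightarrow> carrier_vec d \<and>
        lipschitz_operator d (F i) \<and> strongly_monotone d (F i)) \<and>
    \<not> (\<exists>x\<in>carrier_vec d. \<forall>i\<in>{1..n}. F i x = 0\<^sub>v d) \<and>
    xs \<in> carrier_vec d \<and>
    (\<forall>x\<in>carrier_vec d. batch_op d F {1..n} x = 0\<^sub>v d \<longleftrightarrow> x = xs) \<and>
    x0 \<in> carrier_vec d \<and>
    (\<forall>b (\<gamma>::real) S.
        1 \<le> b \<longrightarrow> b < n \<longrightarrow> \<gamma> > 0 \<longrightarrow> batch_realization n b S \<longrightarrow>
        (\<exists>A. 0 < A \<and> A < 1 \<and> stochastic_critical_condition d F (\<lambda>_. \<gamma>) S x0 A) \<longrightarrow>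
        \<not> (\<lambda>k. euclidean_norm (polyak_seg d F (\<lambda>_. \<gamma>) S x0 k - xs)) \<longlonglongrightarrow> 0)"
proof -
  have components: "\<forall>i\<in>{1..2}. shift_op i \<in> carrier_vec 1 \<rightarrow> carrier_vec 1 \<and>
      lipschitz_operator 1 (shift_op i) \<and> strongly_monotone 1 (shift_op i)"
    by (auto simp: carrier_vec_1_eq lipschitz_shift_op strongly_monotone_shift_op)
  have no_interpolation: "\<not> (\<exists>x\<in>carrier_vec 1. \<forall>i\<in>{1..2}. shift_op i x = 0\<^sub>v 1)"
  proof
    assume "\<exists>x\<in>carrier_vec 1. \<forall>i\<in>{1..2}. shift_op i x = 0\<^sub>v 1"
    then obtain r where zero: "\<forall>i\<in>{1..2}. shift_op i (point r) = 0\<^sub>v 1"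
      unfolding carrier_vec_1_eq by blast
    have "r = center i" if "i \<in> {1..2}" for i
      using bspec[OF zero that] by (simp add: zero_vec_point)
    from this[of 1] this[of 2] show False by (simp add: center_def)
  qed
  have solution: "\<forall>x\<in>carrier_vec 1. batch_op 1 shift_op {1..2} x = 0\<^sub>v 1 \<longleftrightarrow> x = point 0"
    unfolding carrier_vec_1_eq by (auto simp: batch_op_shift_op_full zero_vec_point)
  have divergence: "\<not> (\<lambda>k. euclidean_norm (polyak_seg 1 shift_op (\<lambda>_. \<gamma>) S (point 0) k - point 0)) \<longlonglongrightarrow> 0"
    if "1 \<le> b" "b < 2" "0 < \<gamma>" and S: "batch_realization 2 b S"
      and crit: "\<exists>A. 0 < A \<and> A < 1 \<and>
        stochastic_critical_condition 1 shift_op (\<lambda>_. \<gamma>) S (point 0) A"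
    for b \<gamma> S
  proof -
    have "b = 1" using \<open>1 \<le> b\<close> \<open>b < 2\<close> by linarith
    then have single: "\<exists>i. S k = {i}" for k
      using S unfolding batch_realization_def by (metis card_1_singletonE)
    obtain A i where "A < 1" "stochastic_critical_condition 1 shift_op (\<lambda>_. \<gamma>) S (point 0) A"
        "S 0 = {i}"
      using crit single[of 0] by blast
    then have "\<gamma> < 1"
      by (intro critical_condition_imp_stepsize_less_1[of \<gamma> S A i])
    with \<open>0 < \<gamma>\<close> show ?thesis
      by (rule polyak_seg_not_convergent) (rule single)
  qed
  show ?thesis
  proof (rule exI[of _ 1], rule exI[of _ 2], rule exI[of _ shift_op],
      rule exI[of _ "point 0"], rule exI[of _ "point 0"], intro conjI)
    show "\<forall>b \<gamma> S. 1 \<le> b \<longrightarrow> b < 2 \<longrightarrow> 0 < \<gamma> \<longrightarrow> batch_realization 2 b S \<longrightarrow>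
      (\<exists>A. 0 < A \<and> A < 1 \<and> stochastic_critical_condition 1 shift_op (\<lambda>_. \<gamma>) S (point 0) A) \<longrightarrow>
      \<not> (\<lambda>k. euclidean_norm (polyak_seg 1 shift_op (\<lambda>_. \<gamma>) S (point 0) k - point 0)) \<longlonglongrightarrow> 0"
      by (intro allI impI) (rule divergence)
  qed (rule components no_interpolation solution point_carrier order_refl one_le_numeral)+
qed

end
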